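(* If $S_{\boldsymbol\lambda}$ is a densely defined weighted shift on a directed tree $\mathcal T=(V,E)$ with weights $\boldsymbol\lambda=\{\lambda_v\}_{v\in V^\circ}$, then the following two conditions are equivalent: (i) $\mathcal D(S_{\boldsymbol\lambda}^* )\subseteq\mathcal D(S_{\boldsymbol\lambda})$; (ii) for all $u\in V'$, $T_u$ is defined (i.e. $\boldsymbol\lambda^u\in\mathcal D(M_u)$) and $T_u\in\boldsymbol B(\ell^2(\operatorname{Chi}(u)))$, and $\sup_{u\in V'}\|T_u\|<\infty$.
   Context: A directed tree $\mathcal T=(V,E)$ consists of a nonempty set $V$ (of arbitrary cardinality) of vertices and a set $E\subseteq V\times V\setminus\{(v,v):v\in V\}$ of edges such that: (1) any two distinct vertices $u,v$ are joined by an undirected path, i.e. there are $v_1=u,\dots,v_n=v$ in $V$ ($n\ge 2$) with $(v_j,v_{j+1})\in E$ or $(v_{j+1},v_j)\in E$ for each $j<n$; (2) there is no circuit, i.e. no finite sequence of distinct vertices $u_1,\dots,u_n$ ($n\ge2$) with $(u_j,u_{j+1})\in E$ for $j<n$ and $(u_n,u_1)\in E$; (3) every vertex $v$ that is not a root has a unique vertex $\operatorname{par}(v)$ (its parent) with $(\operatorname{par}(v),v)\in E$; a root is a vertex $v$ for which there is no $u$ with $(u,v)\in E$. A directed tree has at most one root, denoted $\mathrm{root}$ when it exists. $V^\circ$ is $V$ with the root removed (and $V^\circ=V$ if $\mathcal T$ has no root). $\operatorname{Chi}(u)=\{v\in V:(u,v)\in E\}$ and $V'=\{u\in V:\operatorname{Chi}(u)\neq\varnothing\}$.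 $\ell^2(V)$ is the Hilbert space of square summable complex functions on $V$, with orthonormal basis $\{e_u\}_{u\in V}$, $e_u$ being the indicator function of $\{u\}$. For $\boldsymbol\lambda=\{\lambda_v\}_{v\in V^\circ}\subseteq\mathbb C$ and $f\colon V\to\mathbb C$ put $(\Lambda f)(v)=\lambda_v f(\operatorname{par}(v))$ for $v\in V^\circ$ and $(\Lambda f)(\mathrm{root})=0$. The weighted shift $S_{\boldsymbol\lambda}$ is the operator in $\ell^2(V)$ with domain $\mathcal D(S_{\boldsymbol\lambda})=\{f\in\ell^2(V):\Lambda f\in\ell^2(V)\}$ and $S_{\boldsymbol\lambda}f=\Lambda f$. It is densely defined if and only if every $e_u$ lies in its domain, in which case $\|S_{\boldsymbol\lambda}e_u\|^2=\sum_{v\in\operatorname{Chi}(u)}|\lambda_v|^2<\infty$ (sum over the empty set is $0$). $\boldsymbol B(\mathcal H)$ denotes the bounded operators on $\mathcal H$ with domain $\mathcal H$. Let $S_{\boldsymbol\lambda}$ be densely defined and $u\in V'$. The function $\boldsymbol\lambda^u\in\ell^2(\operatorname{Chi}(u))$ is $v\mapsto\lambda_v$. The operator $M_u$ in $\ell^2(\operatorname{Chi}(u))$ has domain $\mathcal D(M_u)=\{g\in\ell^2(\operatorname{Chi}(u)):\sum_{v\in\operatorname{Chi}(u)}\|S_{\boldsymbol\lambda}e_v\|^2|g(v)|^2<\infty\}$ and acts by $(M_ug)(v)=\|S_{\boldsymbol\lambda}e_v\|\,g(v)$. If $\boldsymbol\lambda^u\in\mathcal D(M_u)$, then the operator $T_u$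 in $\ell^2(\operatorname{Chi}(u))$ is $$T_u=M_u^2-\frac1{1+\|S_{\boldsymbol\lambda}e_u\|^2}\,M_u(\boldsymbol\lambda^u)\otimes M_u(\boldsymbol\lambda^u),$$ where $(f\otimes g)(h)=\langle h,g\rangle f$. *)

theory Defs
  imports "HOL-Analysis.Analysis"
begin

section \<open>Directed trees\<close>

definition is_root :: "'v set \<Rightarrow> ('v \<times> 'v) set \<Rightarrow> 'v \<Rightarrow> bool" where
  "is_root V E v \<longleftrightarrow> v \<in> V \<and> \<not> (\<exists>u\<in>V. (u, v) \<in> E)"

definition undirected_path :: "'v set \<Rightarrow> ('v \<times> 'v) set \<Rightarrow> 'v \<Rightarrow> 'v \<Rightarrow> 'v list \<Rightarrow> bool" where
  "undirected_path V E u v p \<longleftrightarrow>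
     2 \<le> length p \<and> set p \<subseteq> V \<and> hd p = u \<and> last p = v \<and>
     successively (\<lambda>x y. (x, y) \<in> E \<or> (y, x) \<in> E) p"

definition circuit :: "('v \<times> 'v) set \<Rightarrow> 'v list \<Rightarrow> bool" where
  "circuit E p \<longleftrightarrow>
     2 \<le> length p \<and> distinct p \<and> successively (\<lambda>x y. (x, y) \<in> E) p \<and> (last p, hd p) \<in> E"

definition directed_tree :: "'v set \<Rightarrow> ('v \<times> 'v) set \<Rightarrow> bool" where
  "directed_tree V E \<longleftrightarrow>
     V \<noteq> {} \<and> E \<subseteq> V \<times> V - {(v, v) | v. v \<in> V} \<and>
     (\<forall>u\<in>V. \<forall>v\<in>V. u \<noteq> v \<longrightarrow> (\<exists>p. undirected_path V E u v p)) \<and>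
     \<not> (\<exists>p. circuit E p) \<and>
     (\<forall>v\<in>V. \<not> is_root V E v \<longrightarrow> (\<exists>!u. u \<in> V \<and> (u, v) \<in> E))"

definition par :: "('v \<times> 'v) set \<Rightarrow> 'v \<Rightarrow> 'v" where
  "par E v = (THE u. (u, v) \<in> E)"

definition nonroots :: "'v set \<Rightarrow> ('v \<times> 'v) set \<Rightarrow> 'v set" where
  "nonroots V E = {v \<in> V. \<not> is_root V E v}"

definition Chi :: "'v set \<Rightarrow> ('v \<times> 'v) set \<Rightarrow> 'v \<Rightarrow> 'v set" where
  "Chi V E u = {v \<in> V. (u, v) \<in> E}"

definition nonleaves :: "'v set \<Rightarrow> ('v \<times> 'v) set \<Rightarrow> 'v set" where
  "nonleaves V E = {u \<in> V. Chi V E u \<noteq> {}}"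


section \<open>The Hilbert space of square summable functions and its operators\<close>

text \<open>
  A function on a set \<open>W\<close> of vertices is represented by its extension by zero to the whole type.
\<close>

definition ell2 :: "'v set \<Rightarrow> ('v \<Rightarrow> complex) set" where
  "ell2 W = {f. (\<forall>v. v \<notin> W \<longrightarrow> f v = 0) \<and> (\<lambda>v. (cmod (f v))\<^sup>2) summable_on W}"

definition ell2_inner :: "'v set \<Rightarrow> ('v \<Rightarrow> complex) \<Rightarrow> ('v \<Rightarrow> complex) \<Rightarrow> complex" where
  "ell2_inner W f g = (\<Sum>\<^sub>\<infinity>v\<in>W. f v * cnj (g v))"

definition ell2_norm :: "'v set \<Rightarrow> ('v \<Rightarrow> complex) \<Rightarrow> real" where
  "ell2_norm W f = sqrt (\<Sum>\<^sub>\<infinity>v\<in>W. (cmod (f v))\<^sup>2)"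

text \<open>
  A possibly unbounded operator is a partial map with domain \<open>dom A\<close>, so that
  \<open>A \<circ>\<^sub>m B\<close> is the operator product with its maximal domain.
\<close>

type_synonym 'v l2op = "('v \<Rightarrow> complex) \<rightharpoonup> ('v \<Rightarrow> complex)"

definition densely_defined :: "'v set \<Rightarrow> 'v l2op \<Rightarrow> bool" where
  "densely_defined W A \<longleftrightarrow>
     dom A \<subseteq> ell2 W \<and>
     (\<forall>f\<in>ell2 W. \<forall>\<epsilon>>0. \<exists>g\<in>dom A. ell2_norm W (\<lambda>v. f v - g v) < \<epsilon>)"

text \<open>
  The description below determines \<open>h\<close> uniquely when \<open>A\<close> is densely defined.
\<close>

definition adj :: "'v set \<Rightarrow> 'v l2op \<Rightarrow> 'v l2op" where
  "adj W A g =
     (if g \<in> ell2 W \<and>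
         (\<exists>h\<in>ell2 W. \<forall>f\<in>dom A. ell2_inner W (the (A f)) g = ell2_inner W f h)
      then Some (THE h. h \<in> ell2 W \<and>
                        (\<forall>f\<in>dom A. ell2_inner W (the (A f)) g = ell2_inner W f h))
      else None)"

definition op_minus :: "'v l2op \<Rightarrow> 'v l2op \<Rightarrow> 'v l2op" where
  "op_minus A B f =
     (if f \<in> dom A \<inter> dom B then Some (\<lambda>v. the (A f) v - the (B f) v) else None)"

definition op_scale :: "complex \<Rightarrow> 'v l2op \<Rightarrow> 'v l2op" where
  "op_scale c A f = map_option (\<lambda>g v. c * g v) (A f)"

definition rank_one :: "'v set \<Rightarrow> ('v \<Rightarrow> complex) \<Rightarrow> ('v \<Rightarrow> complex) \<Rightarrow> 'v l2op" where
  "rank_one W f g h = (if h \<in> ell2 W then Some (\<lambda>v. ell2_inner W h g * f v) else None)"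

definition bounded_op :: "'v set \<Rightarrow> 'v l2op \<Rightarrow> bool" where
  "bounded_op W A \<longleftrightarrow>
     dom A = ell2 W \<and> ran A \<subseteq> ell2 W \<and>
     (\<forall>f\<in>ell2 W. \<forall>g\<in>ell2 W. \<forall>a b.
        the (A (\<lambda>v. a * f v + b * g v)) = (\<lambda>v. a * the (A f) v + b * the (A g) v)) \<and>
     (\<exists>C. \<forall>f\<in>ell2 W. ell2_norm W (the (A f)) \<le> C * ell2_norm W f)"

definition op_norm :: "'v set \<Rightarrow> 'v l2op \<Rightarrow> real" where
  "op_norm W A = (SUP f\<in>{f \<in> ell2 W. ell2_norm W f \<le> 1}. ell2_norm W (the (A f)))"


section \<open>Weighted shifts\<close>

text \<open>
  Only the values of the weight function \<open>l\<close> on \<open>nonroots V E\<close> are ever used.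
\<close>

definition Lam :: "'v set \<Rightarrow> ('v \<times> 'v) set \<Rightarrow> ('v \<Rightarrow> complex) \<Rightarrow> ('v \<Rightarrow> complex) \<Rightarrow> ('v \<Rightarrow> complex)" where
  "Lam V E l f v = (if v \<in> nonroots V E then l v * f (par E v) else 0)"

definition wshift :: "'v set \<Rightarrow> ('v \<times> 'v) set \<Rightarrow> ('v \<Rightarrow> complex) \<Rightarrow> 'v l2op" where
  "wshift V E l f = (if f \<in> ell2 V \<and> Lam V E l f \<in> ell2 V then Some (Lam V E l f) else None)"

text \<open>
  The norm of the image of the basis vector \<open>e\<^sub>u\<close>; meaningful when \<open>e\<^sub>u\<close> is in the domain, which
  is the case for all \<open>u \<in> V\<close> when the weighted shift is densely defined.
\<close>

definition shift_norm :: "'v set \<Rightarrow> ('v \<times> 'v) set \<Rightarrow> ('v \<Rightarrow> complex) \<Rightarrow> 'v \<Rightarrow> real" where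
  "shift_norm V E l u = ell2_norm V (the (wshift V E l (indicator {u})))"

definition lam_at :: "'v set \<Rightarrow> ('v \<times> 'v) set \<Rightarrow> ('v \<Rightarrow> complex) \<Rightarrow> 'v \<Rightarrow> ('v \<Rightarrow> complex)" where
  "lam_at V E l u v = (if v \<in> Chi V E u then l v else 0)"

definition M_op :: "'v set \<Rightarrow> ('v \<times> 'v) set \<Rightarrow> ('v \<Rightarrow> complex) \<Rightarrow> 'v \<Rightarrow> 'v l2op" where
  "M_op V E l u g =
     (if g \<in> ell2 (Chi V E u) \<and>
         (\<lambda>v. (shift_norm V E l v)\<^sup>2 * (cmod (g v))\<^sup>2) summable_on Chi V E u
      then Some (\<lambda>v. complex_of_real (shift_norm V E l v) * g v)
      else None)"

text \<open>
  Meaningful only when \<open>lam_at V E l u \<in> dom (M_op V E l u)\<close>.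
\<close>

definition T_op :: "'v set \<Rightarrow> ('v \<times> 'v) set \<Rightarrow> ('v \<Rightarrow> complex) \<Rightarrow> 'v \<Rightarrow> 'v l2op" where
  "T_op V E l u =
     (let M = M_op V E l u; m = the (M (lam_at V E l u)) in
      op_minus (M \<circ>\<^sub>m M)
        (op_scale (complex_of_real (1 / (1 + (shift_norm V E l u)\<^sup>2)))
          (rank_one (Chi V E u) m m)))"

end

theory Submission
  imports Defs
begin

text \<open>
  Both domains split along the fibres \<open>Chi u\<close>: a function \<open>g \<in> \<ell>\<^sup>2(V)\<close> is in the domain of the
  weighted shift iff \<open>\<Sum>\<^sub>u \<parallel>M\<^sub>u g\<^sub>u\<parallel>\<^sup>2 < \<infinity>\<close>, and in that of the adjoint iff
  \<open>\<Sum>\<^sub>u \<bar>\<langle>g\<^sub>u, \<lambda>\<^sup>u\<rangle>\<bar>\<^sup>2 < \<infinity>\<close>, where \<open>g\<^sub>u\<close> is the restriction of \<open>g\<close> to \<open>Chi u\<close>. By a gliding hump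
  argument the inclusion of domains amounts to \<open>\<parallel>M\<^sub>u g\<parallel>\<^sup>2 \<le> C \<langle>A\<^sub>u g, g\<rangle>\<close> with a constant \<open>C\<close>
  independent of \<open>u\<close>, where \<open>A\<^sub>u = I + \<lambda>\<^sup>u \<otimes> \<lambda>\<^sup>u\<close>. As \<open>T\<^sub>u = M\<^sub>u A\<^sub>u\<^sup>-\<^sup>1 M\<^sub>u\<close>, the best such \<open>C\<close> on the
  fibre over \<open>u\<close> is the norm of \<open>T\<^sub>u\<close>.
\<close>

section \<open>Square summable functions\<close>

lemma ell2D:
  assumes "f \<in> ell2 W"
  shows "v \<notin> W \<Longrightarrow> f v = 0" and "(\<lambda>v. (cmod (f v))\<^sup>2) summable_on W"
  using assms by (auto simp: ell2_def)

lemma ell2_mult_abs_summable: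
  assumes "f \<in> ell2 W" "g \<in> ell2 W"
  shows "(\<lambda>v. cmod (f v * cnj (g v))) summable_on W"
  using ell2D(2)[OF assms(1)] ell2D(2)[OF assms(2)]
    abs_summable_product[of f W "\<lambda>v. cnj (g v)"]
  by (simp add: norm_mult power2_eq_square)

lemma ell2_mult_summable:
  assumes "f \<in> ell2 W" "g \<in> ell2 W"
  shows "(\<lambda>v. f v * cnj (g v)) summable_on W"
  using ell2_mult_abs_summable[OF assms] by (rule abs_summable_summable)

lemma ell2_scale:
  assumes "f \<in> ell2 W"
  shows "(\<lambda>v. c * f v) \<in> ell2 W"
  using assms summable_on_cmult_right[of "\<lambda>v. (cmod (f v))\<^sup>2" W "(cmod c)\<^sup>2"]
  by (simp add: ell2_def norm_mult power_mult_distrib)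

lemma ell2_add:
  assumes "f \<in> ell2 W" "g \<in> ell2 W"
  shows "(\<lambda>v. f v + g v) \<in> ell2 W"
proof -
  have "(cmod (f v + g v))\<^sup>2 \<le> 2 * (cmod (f v))\<^sup>2 + 2 * (cmod (g v))\<^sup>2" for v
  proof -
    have "(cmod (f v + g v))\<^sup>2 \<le> (cmod (f v) + cmod (g v))\<^sup>2"
      by (intro power_mono norm_triangle_ineq) auto
    also have "\<dots> \<le> 2 * (cmod (f v))\<^sup>2 + 2 * (cmod (g v))\<^sup>2"
      using sum_squares_bound[of "cmod (f v)" "cmod (g v)"] by (simp add: power2_sum)
    finally show ?thesis .
  qed
  moreover have "(\<lambda>v. 2 * (cmod (f v))\<^sup>2 + 2 * (cmod (g v))\<^sup>2) summable_on W"
    using assms by (intro summable_on_add summable_on_cmult_right) (auto dest: ell2D)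
  ultimately have "(\<lambda>v. (cmod (f v + g v))\<^sup>2) summable_on W"
    by (intro summable_on_comparison_test[where g = "\<lambda>v. (cmod (f v + g v))\<^sup>2"]) auto
  then show ?thesis
    using assms by (auto simp: ell2_def)
qed

lemma ell2_diff:
  assumes "f \<in> ell2 W" "g \<in> ell2 W"
  shows "(\<lambda>v. f v - g v) \<in> ell2 W"
  using ell2_add[OF assms(1) ell2_scale[OF assms(2), of "-1"]] by simp

lemma ell2_zero: "(\<lambda>v. 0) \<in> ell2 W"
  by (simp add: ell2_def)

lemma ell2_restrict:
  assumes "f \<in> ell2 W" "U \<subseteq> W"
  shows "(\<lambda>v. if v \<in> U then f v else 0) \<in> ell2 U"
proof -
  have "(\<lambda>v. (cmod (if v \<in> U then f v else 0))\<^sup>2) summable_on U \<longleftrightarrow>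
      (\<lambda>v. (cmod (f v))\<^sup>2) summable_on U"
    by (intro summable_on_cong) simp
  then show ?thesis
    using summable_on_subset[OF ell2D(2)[OF assms(1)] assms(2)] by (simp add: ell2_def)
qed

lemma ell2_extend:
  assumes "f \<in> ell2 U" "U \<subseteq> W"
  shows "f \<in> ell2 W"
proof -
  have "(\<lambda>v. (cmod (f v))\<^sup>2) summable_on W \<longleftrightarrow> (\<lambda>v. (cmod (f v))\<^sup>2) summable_on U"
    using assms by (intro summable_on_cong_neutral) (auto dest: ell2D)
  then show ?thesis
    using assms by (auto simp: ell2_def)
qed

section \<open>Norm and inner product\<close>

lemma ell2_norm_nonneg: "0 \<le> ell2_norm W f"
  by (simp add: ell2_norm_def infsum_nonneg)

lemma ell2_norm_power2: "(ell2_norm W f)\<^sup>2 = (\<Sum>\<^sub>\<infinity>v\<in>W. (cmod (f v))\<^sup>2)"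
  by (simp add: ell2_norm_def infsum_nonneg)

lemma ell2_norm_scale: "ell2_norm W (\<lambda>v. c * f v) = cmod c * ell2_norm W f"
  by (simp add: ell2_norm_def norm_mult power_mult_distrib infsum_cmult_right' real_sqrt_mult)

lemma ell2_inner_self:
  assumes "f \<in> ell2 W"
  shows "ell2_inner W f f = complex_of_real ((ell2_norm W f)\<^sup>2)"
proof -
  have "((\<lambda>v. complex_of_real ((cmod (f v))\<^sup>2)) has_sum complex_of_real ((ell2_norm W f)\<^sup>2)) W"
    unfolding ell2_norm_power2 by (intro has_sum_of_real has_sum_infsum ell2D(2)[OF assms])
  then show ?thesis
    unfolding ell2_inner_def by (intro infsumI) (simp only: complex_norm_square)
qed

lemma ell2_inner_cnj: "cnj (ell2_inner W f g) = ell2_inner W g f"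
  unfolding ell2_inner_def infsum_cnj[symmetric] by (simp add: mult.commute)

lemma ell2_inner_scale_left: "ell2_inner W (\<lambda>v. c * f v) g = c * ell2_inner W f g"
  by (simp add: ell2_inner_def mult.assoc infsum_cmult_right')

lemma ell2_inner_scale_right: "ell2_inner W f (\<lambda>v. c * g v) = cnj c * ell2_inner W f g"
  by (simp add: ell2_inner_def mult.left_commute infsum_cmult_right')

lemma ell2_inner_diff_left:
  assumes "f \<in> ell2 W" "g \<in> ell2 W" "h \<in> ell2 W"
  shows "ell2_inner W (\<lambda>v. f v - g v) h = ell2_inner W f h - ell2_inner W g h"
proof -
  have "((\<lambda>v. f v * cnj (h v) + - (g v * cnj (h v))) has_sum
      (ell2_inner W f h + - ell2_inner W g h)) W"
    unfolding ell2_inner_def using assms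
    by (intro has_sum_add has_sum_uminusI has_sum_infsum ell2_mult_summable)
  then show ?thesis
    unfolding ell2_inner_def[of W "\<lambda>v. f v - g v"] by (intro infsumI) (simp add: left_diff_distrib)
qed

lemma ell2_inner_diff_right:
  assumes "f \<in> ell2 W" "g \<in> ell2 W" "h \<in> ell2 W"
  shows "ell2_inner W h (\<lambda>v. f v - g v) = ell2_inner W h f - ell2_inner W h g"
  using ell2_inner_diff_left[OF assms] by (metis complex_cnj_diff ell2_inner_cnj)

text \<open>The product series converges absolutely, so it suffices to bound its finite partial
  sums, where the finite inequality for \<open>L2_set\<close> applies.\<close>

lemma ell2_Cauchy_Schwarz:
  assumes "f \<in> ell2 W" "g \<in> ell2 W"
  shows "cmod (ell2_inner W f g) \<le> ell2_norm W f * ell2_norm W g"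
proof -
  note abs = ell2_mult_abs_summable[OF assms]
  have part: "L2_set (\<lambda>v. cmod (h v)) F \<le> ell2_norm W h"
    if "finite F" "F \<subseteq> W" "h \<in> ell2 W" for F h
    unfolding L2_set_def ell2_norm_def
    using that by (intro real_sqrt_le_mono finite_sum_le_infsum) (auto dest: ell2D)
  have "cmod (ell2_inner W f g) \<le> (\<Sum>\<^sub>\<infinity>v\<in>W. cmod (f v * cnj (g v)))"
    unfolding ell2_inner_def by (rule norm_infsum_bound[OF abs])
  also have "\<dots> \<le> ell2_norm W f * ell2_norm W g"
  proof (rule infsum_le_finite_sums[OF abs])
    fix F assume F: "finite F" "F \<subseteq> W"
    have "(\<Sum>v\<in>F. cmod (f v * cnj (g v))) \<le> L2_set (\<lambda>v. cmod (f v)) F * L2_set (\<lambda>v. cmod (g v)) F"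
      using L2_set_mult_ineq[of "\<lambda>v. cmod (f v)" "\<lambda>v. cmod (g v)" F] by (simp add: norm_mult)
    also have "\<dots> \<le> ell2_norm W f * ell2_norm W g"
      using F assms by (intro mult_mono part L2_set_nonneg ell2_norm_nonneg)
    finally show "(\<Sum>v\<in>F. cmod (f v * cnj (g v))) \<le> ell2_norm W f * ell2_norm W g" .
  qed
  finally show ?thesis .
qed

section \<open>Selecting a sparse sequence for the gliding hump\<close>

text \<open>Pick points \<open>f n\<close> with \<open>c (f n) > 2 ^ n\<close> and with
  \<open>c\<close> strictly increasing along \<open>f\<close>. The growth bounds the inverses by a
  geometric series; the strict increase makes \<open>f\<close> injective, so that
  \<open>J = range f\<close> is infinite.\<close>

lemma unbounded_imp_summable_inverse:
  fixes c :: "'a \<Rightarrow> real"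
  assumes unbounded: "\<And>K. \<exists>x\<in>I. K < c x"
  obtains J where "J \<subseteq> I" "infinite J" "\<And>x. x \<in> J \<Longrightarrow> 0 < c x"
    "(\<lambda>x. inverse (c x)) summable_on J"
proof -
  have "\<exists>f. \<forall>n. (f n \<in> I \<and> 2 ^ n < c (f n)) \<and> c (f n) < c (f (Suc n))"
  proof (rule dependent_nat_choice)
    show "\<exists>x. x \<in> I \<and> 2 ^ 0 < c x"
      using unbounded by blast
    show "\<exists>y. (y \<in> I \<and> 2 ^ Suc n < c y) \<and> c x < c y" for x n
      using unbounded[of "max (2 ^ Suc n) (c x)"] by auto
  qed
  then obtain f where f: "f n \<in> I" "2 ^ n < c (f n)" "c (f n) < c (f (Suc n))" for n
    by blast
  have "strict_mono (\<lambda>n. c (f n))"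
    using f(3) by (simp add: strict_mono_Suc_iff)
  then have "inj (\<lambda>n. c (f n))"
    by (rule strict_mono_imp_inj_on)
  then have inj: "inj f"
    by (auto simp: inj_on_def)
  have pos: "0 < c (f n)" for n
    using f(2)[of n] by (rule order_less_trans[rotated]) simp
  have le: "inverse (c (f n)) \<le> (1 / 2) ^ n" for n
    using f(2)[of n] pos[of n] by (simp add: power_divide inverse_eq_divide frac_le)
  have "summable (\<lambda>n. inverse (c (f n)))"
    using le pos by (intro summable_comparison_test'[OF summable_geometric[of "1/2::real"], of 0])
      (auto simp: less_imp_le)
  then have "(\<lambda>n. inverse (c (f n))) summable_on UNIV"
    using pos by (subst summable_on_UNIV_nonneg_real_iff) (auto simp: less_imp_le)
  then have "(\<lambda>x. inverse (c x)) summable_on range f"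
    using inj by (simp add: summable_on_reindex o_def)
  then show thesis
    using f(1) pos inj by (intro that[of "range f"]) (auto simp: finite_image_iff)
qed


section \<open>Rank one perturbations on a single fibre\<close>

text \<open>A total version of the multiplication operator: membership of the image in
  \<open>ell2\<close> takes over the role of the domain.\<close>

definition diag_op :: "('v \<Rightarrow> real) \<Rightarrow> ('v \<Rightarrow> complex) \<Rightarrow> ('v \<Rightarrow> complex)" where
  "diag_op s f v = complex_of_real (s v) * f v"

text \<open>
  The operator \<open>A = I + lam \<otimes> lam\<close> enters through its quadratic form and through its inverse,
  which is given by the Sherman--Morrison formula.
\<close>

definition A_form :: "'v set \<Rightarrow> ('v \<Rightarrow> complex) \<Rightarrow> ('v \<Rightarrow> complex) \<Rightarrow> real" where
  "A_form W lam g = (ell2_norm W g)\<^sup>2 + (cmod (ell2_inner W g lam))\<^sup>2"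

definition A_inv :: "'v set \<Rightarrow> ('v \<Rightarrow> complex) \<Rightarrow> ('v \<Rightarrow> complex) \<Rightarrow> ('v \<Rightarrow> complex)" where
  "A_inv W lam h v =
     h v - complex_of_real (1 / (1 + (ell2_norm W lam)\<^sup>2)) * ell2_inner W h lam * lam v"

lemma diag_op_scale: "diag_op s (\<lambda>v. c * f v) = (\<lambda>v. c * diag_op s f v)"
  by (simp add: diag_op_def fun_eq_iff)

lemma A_form_nonneg: "0 \<le> A_form W lam g"
  by (simp add: A_form_def)

lemma A_form_scale: "A_form W lam (\<lambda>v. c * f v) = (cmod c)\<^sup>2 * A_form W lam f"
  by (simp add: A_form_def ell2_norm_scale ell2_inner_scale_left norm_mult power_mult_distrib
      distrib_left)

text \<open>The second assumption makes the multiplication operator everywhere defined, so no domain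
  questions arise when \<open>M\<close>, \<open>Ainv\<close> and \<open>M\<close> are
  composed.\<close>

locale fibre =
  fixes W :: "'v set" and lam :: "'v \<Rightarrow> complex" and s :: "'v \<Rightarrow> real"
  assumes lam: "lam \<in> ell2 W"
    and diag_op_ell2: "f \<in> ell2 W \<Longrightarrow> diag_op s f \<in> ell2 W"
begin

abbreviation "M \<equiv> diag_op s"
abbreviation "N \<equiv> A_form W lam"
abbreviation "Ainv \<equiv> A_inv W lam"

lemma Ainv_ell2: "h \<in> ell2 W \<Longrightarrow> Ainv h \<in> ell2 W"
  unfolding A_inv_def[abs_def] by (intro ell2_diff ell2_scale lam)

lemma M_sym: "ell2_inner W (M f) g = ell2_inner W f (M g)"
  by (simp add: ell2_inner_def diag_op_def algebra_simps)

text \<open>The left side is \<open><g, A w>\<close> for \<open>w = Ainv h\<close> and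
  \<open>A = I + lam \<otimes> lam\<close>, so this is the weak form of
  \<open>A (Ainv h) = h\<close>. It rests on \<open><Ainv h, lam> = d <h, lam>\<close> with
  \<open>d = 1 / (1 + ||lam||^2)\<close>.\<close>

lemma A_Ainv:
  assumes "g \<in> ell2 W" "h \<in> ell2 W"
  shows "ell2_inner W g (Ainv h) + ell2_inner W g lam * cnj (ell2_inner W (Ainv h) lam)
    = ell2_inner W g h"
proof -
  define L where "L = (ell2_norm W lam)\<^sup>2"
  define p where "p = ell2_inner W h lam"
  define q where "q = ell2_inner W g lam"
  define d where "d = complex_of_real (1 / (1 + L))"
  have L: "1 + complex_of_real L \<noteq> 0"
    by (metis L_def add_pos_nonneg of_real_1 of_real_add of_real_eq_0_iff order_less_irrefl
        zero_le_power2 zero_less_one)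
  then have d: "d * (1 + complex_of_real L) = 1"
    by (simp add: d_def)
  have cnj_d: "cnj d = d"
    by (simp add: d_def)
  have w: "Ainv h = (\<lambda>v. h v - (d * p) * lam v)"
    by (simp add: A_inv_def[abs_def] d_def p_def L_def)
  have 1: "ell2_inner W g (Ainv h) = ell2_inner W g h - d * cnj p * q"
    unfolding w using assms lam
    by (simp add: ell2_inner_diff_right ell2_scale ell2_inner_scale_right q_def cnj_d)
  have "ell2_inner W (Ainv h) lam = p - d * p * L"
    unfolding w using assms lam
    by (simp add: ell2_inner_diff_left ell2_scale ell2_inner_scale_left ell2_inner_self L_def p_def)
  also have "\<dots> = d * p"
  proof -
    have "p - d * p * complex_of_real L = p * (d * (1 + complex_of_real L)) - d * p * complex_of_real L"
      by (simp only: d mult_1_right)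
    also have "\<dots> = d * p"
      by (simp add: algebra_simps)
    finally show ?thesis .
  qed
  finally have "cnj (ell2_inner W (Ainv h) lam) = d * cnj p"
    by (simp add: cnj_d)
  then show ?thesis
    using 1 by (simp add: q_def algebra_simps)
qed

text \<open>For \<open>w = Ainv h\<close> this reads \<open><A w, w> = <w, h>\<close>: the previous
  identity with \<open>g = w\<close>.\<close>

lemma N_Ainv:
  assumes "h \<in> ell2 W"
  shows "complex_of_real (N (Ainv h)) = ell2_inner W (Ainv h) h"
  using A_Ainv[OF Ainv_ell2[OF assms] assms]
  by (simp add: A_form_def ell2_inner_self[OF Ainv_ell2[OF assms]] complex_norm_square
      del: of_real_power)

text \<open>Cauchy-Schwarz for the inner product induced by \<open>A\<close>, because
  \<open><g, h> = <g, A w>\<close> with \<open>w = Ainv h\<close>. It is obtained from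
  Cauchy-Schwarz in \<open>ell2 W\<close> followed by its two-term real version.\<close>

lemma cmod_inner_le:
  assumes "g \<in> ell2 W" "h \<in> ell2 W"
  shows "(cmod (ell2_inner W g h))\<^sup>2 \<le> N g * N (Ainv h)"
proof -
  define w where "w = Ainv h"
  define x y a b where "x = ell2_norm W g" and "y = ell2_norm W w"
    and "a = cmod (ell2_inner W g lam)" and "b = cmod (ell2_inner W w lam)"
  have "cmod (ell2_inner W g h) = cmod (ell2_inner W g w + ell2_inner W g lam * cnj (ell2_inner W w lam))"
    using A_Ainv[OF assms] by (simp add: w_def)
  also have "\<dots> \<le> cmod (ell2_inner W g w) + a * b"
    by (rule order_trans[OF norm_triangle_ineq]) (simp add: norm_mult a_def b_def)
  also have "\<dots> \<le> x * y + a * b"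
    using ell2_Cauchy_Schwarz[OF assms(1) Ainv_ell2[OF assms(2)]]
    by (simp add: x_def y_def w_def)
  finally have "(cmod (ell2_inner W g h))\<^sup>2 \<le> (x * y + a * b)\<^sup>2"
    by (intro power_mono) auto
  also have "\<dots> \<le> (x\<^sup>2 + a\<^sup>2) * (y\<^sup>2 + b\<^sup>2)"
    using zero_le_power2[of "x * b - a * y"] by (simp add: power2_eq_square algebra_simps)
  finally show ?thesis
    by (simp add: A_form_def x_def y_def a_def b_def w_def)
qed

text \<open>
  Since \<open>T = M A\<^sup>-\<^sup>1 M = B B\<^sup>*\<close> with \<open>B = M A\<^sup>-\<^sup>1\<^sup>/\<^sup>2\<close>, the norm of \<open>T\<close> is the best constant in
  \<open>\<parallel>M g\<parallel>\<^sup>2 \<le> C \<langle>A g, g\<rangle>\<close>; the next two lemmas say this without using the square root of \<open>A\<close>.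
\<close>

lemma M_le_of_T_le:
  assumes g: "g \<in> ell2 W" and C: "0 \<le> C"
    and T: "\<And>k. k \<in> ell2 W \<Longrightarrow> ell2_norm W (M (Ainv (M k))) \<le> C * ell2_norm W k"
  shows "(ell2_norm W (M g))\<^sup>2 \<le> C * N g"
proof -
  define k where "k = M g"
  define h where "h = M k"
  have k: "k \<in> ell2 W" and h: "h \<in> ell2 W"
    using g by (simp_all add: k_def h_def diag_op_ell2)
  define x where "x = (ell2_norm W k)\<^sup>2"
  \<comment> \<open>Since \<open>h = M k\<close> and \<open>M\<close> is symmetric,
    \<open><Ainv h, h> = <M (Ainv h), k>\<close>, which brings in the operator that \<open>T\<close>
    controls.\<close>
  have "N (Ainv h) = cmod (ell2_inner W (M (Ainv h)) k)"
    using N_Ainv[OF h] A_form_nonneg[of W lam "Ainv h"]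
    by (metis M_sym abs_of_nonneg h_def norm_of_real)
  also have "\<dots> \<le> ell2_norm W (M (Ainv h)) * ell2_norm W k"
    by (intro ell2_Cauchy_Schwarz diag_op_ell2 Ainv_ell2 h k)
  also have "\<dots> \<le> C * ell2_norm W k * ell2_norm W k"
    using T[OF k] by (intro mult_right_mono ell2_norm_nonneg) (simp add: h_def)
  finally have Nw: "N (Ainv h) \<le> C * x"
    by (simp add: x_def power2_eq_square mult.assoc)
  \<comment> \<open>The choice \<open>h = M (M g)\<close> turns \<open><g, h>\<close> into
    \<open>||M g||^2\<close>; the resulting quadratic inequality in \<open>x\<close> is then divided
    by \<open>x\<close>.\<close>
  have "ell2_inner W g h = complex_of_real x"
    using M_sym[of g k] by (simp add: h_def x_def ell2_inner_self[OF k] flip: k_def)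
  then have "x\<^sup>2 \<le> N g * N (Ainv h)"
    using cmod_inner_le[OF g h] by (simp only: norm_of_real power2_abs)
  also have "\<dots> \<le> N g * (C * x)"
    by (intro mult_left_mono Nw A_form_nonneg)
  finally have "x * x \<le> (C * N g) * x"
    by (simp add: power2_eq_square algebra_simps)
  moreover have "0 \<le> C * N g" "0 \<le> x"
    using C by (simp_all add: A_form_nonneg x_def)
  ultimately show ?thesis
    unfolding x_def[symmetric] k_def[symmetric] by (cases "x = 0") auto
qed

lemma T_le_of_M_le:
  assumes k: "k \<in> ell2 W"
    and Q: "\<And>g. g \<in> ell2 W \<Longrightarrow> (ell2_norm W (M g))\<^sup>2 \<le> C * N g"
    and C: "0 \<le> C"
  shows "ell2_norm W (M (Ainv (M k))) \<le> C * ell2_norm W k"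
proof -
  define w where "w = Ainv (M k)"
  define t where "t = ell2_norm W (M w)"
  have w: "w \<in> ell2 W"
    using k by (simp add: w_def diag_op_ell2 Ainv_ell2)
  have "N w = cmod (ell2_inner W (M w) k)"
    using N_Ainv[OF diag_op_ell2[OF k]] A_form_nonneg[of W lam w]
    by (metis M_sym abs_of_nonneg w_def norm_of_real)
  also have "\<dots> \<le> t * ell2_norm W k"
    unfolding t_def by (intro ell2_Cauchy_Schwarz diag_op_ell2 w k)
  finally have "N w \<le> t * ell2_norm W k" .
  then have "t\<^sup>2 \<le> C * (t * ell2_norm W k)"
    using Q[OF w] C unfolding t_def by (meson mult_left_mono order_trans)
  then have "t * t \<le> (C * ell2_norm W k) * t"
    by (simp add: power2_eq_square algebra_simps)
  moreover have "0 \<le> t" "0 \<le> C * ell2_norm W k"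
    using C by (simp_all add: t_def ell2_norm_nonneg)
  ultimately show ?thesis
    unfolding w_def[symmetric] t_def[symmetric] by (cases "t = 0") auto
qed

end

section \<open>Operator norms\<close>

text \<open>The constant supplied by \<open>bounded_op\<close> bounds the set under the real
  supremum \<open>op_norm\<close>, so each unit vector is controlled by it; homogeneity does the
  rest.\<close>

lemma op_norm_le:
  assumes A: "bounded_op W A" and f: "f \<in> ell2 W"
  shows "ell2_norm W (the (A f)) \<le> op_norm W A * ell2_norm W f"
proof -
  from A obtain C where C: "\<And>f. f \<in> ell2 W \<Longrightarrow> ell2_norm W (the (A f)) \<le> C * ell2_norm W f"
    unfolding bounded_op_def by blast
  define B where "B = {f \<in> ell2 W. ell2_norm W f \<le> 1}"
  have "ell2_norm W (the (A h)) \<le> \<bar>C\<bar>" if "h \<in> B" for h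
  proof -
    have h: "h \<in> ell2 W" "ell2_norm W h \<le> 1"
      using that by (auto simp: B_def)
    have "C * ell2_norm W h \<le> \<bar>C\<bar> * 1"
      using h(2) by (intro mult_mono) (auto simp: ell2_norm_nonneg)
    then show ?thesis
      using C[OF h(1)] by simp
  qed
  then have bdd: "bdd_above ((\<lambda>h. ell2_norm W (the (A h))) ` B)"
    by (auto intro!: bdd_aboveI)
  show ?thesis
  \<comment> \<open>A vector of norm zero cannot be normalised; there the constant \<open>C\<close>
    already gives the claim.\<close>
  proof (cases "ell2_norm W f = 0")
    case True
    then show ?thesis
      using C[OF f] by simp
  next
    case False
    define r where "r = ell2_norm W f"
    have r: "0 < r"
      using False ell2_norm_nonneg[of W f] by (simp add: r_def)
    define h where "h = (\<lambda>v. complex_of_real (1 / r) * f v)"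
    have h: "h \<in> ell2 W"
      unfolding h_def using f by (rule ell2_scale)
    have "ell2_norm W h = 1"
      unfolding h_def ell2_norm_scale using r by (simp add: r_def norm_divide)
    with h have hB: "h \<in> B"
      by (simp add: B_def)
    \<comment> \<open>Homogeneity is the linearity clause with both vectors equal to
      \<open>f\<close> and second coefficient 0.\<close>
    have lin: "the (A (\<lambda>v. a * f v + b * f v)) = (\<lambda>v. a * the (A f) v + b * the (A f) v)" for a b
      using A f unfolding bounded_op_def by blast
    have "the (A h) = (\<lambda>v. complex_of_real (1 / r) * the (A f) v)"
      using lin[of "complex_of_real (1 / r)" 0] by (simp add: h_def)
    then have "ell2_norm W (the (A h)) = ell2_norm W (the (A f)) / r"
      using r by (simp only: ell2_norm_scale norm_of_real) simp
    moreover have "ell2_norm W (the (A h)) \<le> op_norm W A"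
      unfolding op_norm_def B_def[symmetric] by (rule cSUP_upper[OF hB bdd])
    ultimately show ?thesis
      using r by (simp add: r_def field_simps)
  qed
qed

lemma op_norm_leI:
  assumes "0 \<le> C" and "\<And>f. f \<in> ell2 W \<Longrightarrow> ell2_norm W (the (A f)) \<le> C * ell2_norm W f"
  shows "op_norm W A \<le> C"
  unfolding op_norm_def
proof (rule cSUP_least)
  have "ell2_norm W (\<lambda>v. 0) \<le> 1"
    by (simp add: ell2_norm_def)
  then show "{f \<in> ell2 W. ell2_norm W f \<le> 1} \<noteq> {}"
    using ell2_zero by blast
  fix f assume f: "f \<in> {f \<in> ell2 W. ell2_norm W f \<le> 1}"
  then have "C * ell2_norm W f \<le> C * 1"
    by (intro mult_left_mono assms(1)) auto
  then show "ell2_norm W (the (A f)) \<le> C"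
    using assms(2)[of f] f by simp
qed


section \<open>Weighted shifts on directed trees\<close>

text \<open>Every vertex on an undirected path that starts at a root is a descendant of that root. A
  second root would thus be a descendant of the first and have a parent.\<close>

lemma directed_tree_root_unique:
  assumes "directed_tree V E" "is_root V E u" "is_root V E v"
  shows "u = v"
proof (rule ccontr)
  assume "u \<noteq> v"
  have uV: "u \<in> V" and vV: "v \<in> V"
    using assms by (auto simp: is_root_def)
  have unique: "x = y" if "(x, z) \<in> E" "(y, z) \<in> E" for x y z
  proof -
    have "x \<in> V" "y \<in> V" "z \<in> V"
      using that assms(1) by (auto simp: directed_tree_def)
    then show ?thesis
      using that assms(1) unfolding directed_tree_def is_root_def by metis
  qed
  have desc: "(u, last p) \<in> E\<^sup>*"
    if "p \<noteq> []" "successively (\<lambda>x y. (x, y) \<in> E \<or> (y, x) \<in> E) p" "hd p = u" "set p \<subseteq> V" for p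
    using that
  proof (induction p rule: rev_induct)
    case (snoc y p)
    show ?case
    proof (cases "p = []")
      case False
      then have IH: "(u, last p) \<in> E\<^sup>*" and y: "(last p, y) \<in> E \<or> (y, last p) \<in> E"
        using snoc by (auto simp: successively_append_iff)
      from y show ?thesis
      proof
        assume "(last p, y) \<in> E"
        with IH show ?thesis
          by simp
      next
        \<comment> \<open>A backward step leads to the parent of \<open>last p\<close>. As parents
          are unique, that parent is the predecessor of \<open>last p\<close> on a directed path
          from \<open>u\<close>, hence itself a descendant.\<close>
        assume yE: "(y, last p) \<in> E"
        have "y \<in> V"
          using snoc.prems by simp
        with yE assms(2) have "last p \<noteq> u"
          by (auto simp: is_root_def)
        with IH obtain z where "(u, z) \<in> E\<^sup>*" "(z, last p) \<in> E"
          by (metis rtranclE)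
        with unique[OF yE] show ?thesis
          by simp
      qed
    qed (use snoc.prems in auto)
  qed simp
  obtain p where p: "undirected_path V E u v p"
    using assms(1) uV vV \<open>u \<noteq> v\<close> unfolding directed_tree_def by blast
  then have "p \<noteq> []"
    by (auto simp: undirected_path_def)
  then have "(u, v) \<in> E\<^sup>*"
    using desc[of p] p by (auto simp: undirected_path_def)
  with \<open>u \<noteq> v\<close> obtain z where "(z, v) \<in> E"
    by (metis rtranclE)
  moreover have "E \<subseteq> V \<times> V"
    using assms(1) by (auto simp: directed_tree_def)
  ultimately show False
    using assms(3) by (auto simp: is_root_def)
qed

section \<open>Splitting the tree into the fibres over parents\<close>

locale tree_shift =
  fixes V :: "'v set" and E :: "('v \<times> 'v) set" and l :: "'v \<Rightarrow> complex"
  assumes tree: "directed_tree V E" and dense: "densely_defined V (wshift V E l)"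
begin

abbreviation "ch \<equiv> Chi V E"
abbreviation "sn \<equiv> shift_norm V E l"
abbreviation "lam \<equiv> lam_at V E l"

lemma Chi_subset: "ch u \<subseteq> V"
  by (auto simp: Chi_def)

lemma edge_in_V: "(u, v) \<in> E \<Longrightarrow> u \<in> V \<and> v \<in> V"
  using tree by (auto simp: directed_tree_def)

lemma parent_unique: "(x, z) \<in> E \<Longrightarrow> (y, z) \<in> E \<Longrightarrow> x = y"
  using tree edge_in_V[of x z] edge_in_V[of y z] unfolding directed_tree_def is_root_def by metis

lemma par_eq: "v \<in> ch u \<Longrightarrow> par E v = u"
  unfolding par_def Chi_def by (auto intro!: the_equality dest: parent_unique)

lemma Chi_nonroots: "v \<in> ch u \<Longrightarrow> v \<in> nonroots V E"
  using edge_in_V by (auto simp: nonroots_def Chi_def is_root_def)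

lemma nonroots_eq: "nonroots V E = (\<Union>u\<in>V. ch u)"
  by (auto simp: nonroots_def Chi_def is_root_def)

lemma disjoint_Chi: "disjoint_family_on ch V"
  unfolding disjoint_family_on_def Chi_def by (auto dest: parent_unique)

lemma Lam_Chi: "v \<in> ch u \<Longrightarrow> Lam V E l f v = l v * f u"
  by (simp add: Lam_def par_eq Chi_nonroots)

text \<open>The nonroots are the disjoint union of the sets \<open>ch u\<close>, and for nonnegative
  terms summing fibre by fibre is equivalent to summing at once. At most one root remains, which
  does not affect summability.\<close>

lemma summable_on_tree_iff:
  fixes f :: "'v \<Rightarrow> real"
  assumes nonneg: "\<And>v. 0 \<le> f v"
  shows "f summable_on V \<longleftrightarrow>
    (\<forall>u\<in>V. f summable_on ch u) \<and> (\<lambda>u. infsum f (ch u)) summable_on V"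
proof -
  have "finite {v. is_root V E v}"
  proof (cases "\<exists>u. is_root V E u")
    case True
    then obtain u where "is_root V E u"
      by blast
    then have "{v. is_root V E v} \<subseteq> {u}"
      using directed_tree_root_unique[OF tree] by blast
    then show ?thesis
      by (rule finite_subset) simp
  qed simp
  then have roots: "f summable_on {v. is_root V E v}"
    by simp
  have V: "V = nonroots V E \<union> {v. is_root V E v}"
    by (auto simp: nonroots_def is_root_def)
  have "f summable_on V \<longleftrightarrow> f summable_on nonroots V E"
  proof
    assume "f summable_on V"
    then show "f summable_on nonroots V E"
      by (rule summable_on_subset) (auto simp: nonroots_def)
  next
    assume "f summable_on nonroots V E"
    then show "f summable_on V"
      using roots by (subst V) (rule summable_on_union)
  qed
  also have "\<dots> \<longleftrightarrow> (\<forall>u\<in>V. f summable_on ch u) \<and> (\<lambda>u. infsum f (ch u)) summable_on V"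
  proof (cases "\<forall>u\<in>V. f summable_on ch u")
    case True
    then show ?thesis
      unfolding nonroots_eq using nonneg disjoint_Chi
      by (subst summable_on_Union_iff[where g = "\<lambda>u. infsum f (ch u)"]) auto
  next
    case False
    have "f summable_on ch u" if "f summable_on nonroots V E" "u \<in> V" for u
      using that(1) by (rule summable_on_subset) (use that(2) nonroots_eq in auto)
    with False show ?thesis
      by blast
  qed
  finally show ?thesis .
qed

lemma indicator_ell2: "u \<in> V \<Longrightarrow> indicator {u} \<in> ell2 V"
  unfolding ell2_def
  by (auto intro!: finite_nonzero_values_imp_summable_on finite_subset[of _ "{u}"]
      simp: indicator_def)

text \<open>Density yields \<open>g\<close> in the domain at distance less than 1 from the basis
  vector at \<open>u\<close>, so \<open>g u\<close> is nonzero. On \<open>ch u\<close> the image of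
  \<open>g\<close> is \<open>l v * g u\<close>, and the factor \<open>g u\<close> can be
  cancelled.\<close>

lemma weights_summable:
  assumes u: "u \<in> V"
  shows "(\<lambda>v. (cmod (l v))\<^sup>2) summable_on ch u"
proof -
  define e :: "'v \<Rightarrow> complex" where "e = indicator {u}"
  have e: "e \<in> ell2 V"
    unfolding e_def using u by (rule indicator_ell2)
  then obtain g where g: "g \<in> dom (wshift V E l)" and less: "ell2_norm V (\<lambda>v. e v - g v) < 1"
    using dense unfolding densely_defined_def by (meson zero_less_one)
  have gV: "g \<in> ell2 V" and Lg: "Lam V E l g \<in> ell2 V"
    using g by (auto simp: wshift_def dom_def split: if_splits)
  have "g u \<noteq> 0"
  proof
    assume "g u = 0"
    have "(\<Sum>v\<in>{u}. (cmod (e v - g v))\<^sup>2) \<le> (ell2_norm V (\<lambda>v. e v - g v))\<^sup>2"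
      unfolding ell2_norm_power2 using u ell2D(2)[OF ell2_diff[OF e gV]]
      by (intro finite_sum_le_infsum) auto
    then have "1 \<le> (ell2_norm V (\<lambda>v. e v - g v))\<^sup>2"
      using \<open>g u = 0\<close> by (simp add: e_def)
    moreover have "(ell2_norm V (\<lambda>v. e v - g v))\<^sup>2 < 1"
      using less by (simp add: ell2_norm_nonneg power_less_one_iff)
    ultimately show False
      by simp
  qed
  have "(\<lambda>v. (cmod (Lam V E l g v))\<^sup>2) summable_on ch u"
    using ell2D(2)[OF Lg] Chi_subset by (rule summable_on_subset)
  also have "?this \<longleftrightarrow> (\<lambda>v. (cmod (l v))\<^sup>2 * (cmod (g u))\<^sup>2) summable_on ch u"
    by (intro summable_on_cong) (simp add: Lam_Chi norm_mult power_mult_distrib)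
  also have "\<dots> \<longleftrightarrow> (\<lambda>v. (cmod (l v))\<^sup>2) summable_on ch u"
    using \<open>g u \<noteq> 0\<close> by (intro summable_on_cmult_left') simp
  finally show ?thesis .
qed

lemma lam_ell2: "u \<in> V \<Longrightarrow> lam u \<in> ell2 (ch u)"
  using weights_summable[of u]
  by (auto simp: ell2_def lam_at_def intro: summable_on_cong[THEN iffD1, rotated])

lemma wshift_indicator:
  assumes "u \<in> V"
  shows "wshift V E l (indicator {u}) = Some (lam u)"
proof -
  have "Lam V E l (indicator {u}) = lam u"
  proof
    fix v
    show "Lam V E l (indicator {u}) v = lam u v"
    proof (cases "v \<in> nonroots V E")
      case True
      then obtain w where "v \<in> ch w"
        by (auto simp: nonroots_eq)
      then show ?thesis
        using par_eq by (auto simp: Lam_Chi lam_at_def indicator_def)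
    next
      case False
      then show ?thesis
        using Chi_nonroots by (auto simp: Lam_def lam_at_def)
    qed
  qed
  moreover have "lam u \<in> ell2 V"
    using lam_ell2[OF assms] Chi_subset by (rule ell2_extend)
  ultimately show ?thesis
    using indicator_ell2[OF assms] by (simp add: wshift_def)
qed

lemma norm_lam: "u \<in> V \<Longrightarrow> ell2_norm (ch u) (lam u) = sn u"
  unfolding shift_norm_def ell2_norm_def wshift_indicator option.sel
  by (intro arg_cong[where f = sqrt] infsum_cong_neutral) (auto simp: lam_at_def Chi_def)

lemma shift_norm_power2:
  assumes "u \<in> V"
  shows "(sn u)\<^sup>2 = (\<Sum>\<^sub>\<infinity>v\<in>ch u. (cmod (l v))\<^sup>2)"
  unfolding norm_lam[OF assms, symmetric] ell2_norm_power2
  by (intro infsum_cong) (simp add: lam_at_def)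

section \<open>The domains of the shift and of its adjoint, fibre by fibre\<close>

text \<open>On \<open>ch u\<close> the function \<open>Lam V E l f\<close> is a multiple by
  \<open>f u\<close> of the weights, so its squared norm there is
  \<open>(sn u)\<^sup>2 * (cmod (f u))\<^sup>2\<close>.\<close>

lemma dom_wshift:
  "f \<in> dom (wshift V E l) \<longleftrightarrow>
    f \<in> ell2 V \<and> (\<lambda>u. (sn u)\<^sup>2 * (cmod (f u))\<^sup>2) summable_on V"
proof -
  have cong: "(cmod (Lam V E l f v))\<^sup>2 = (cmod (l v))\<^sup>2 * (cmod (f u))\<^sup>2" if "v \<in> ch u" for u v
    using that by (simp add: Lam_Chi norm_mult power_mult_distrib)
  have 1: "(\<lambda>v. (cmod (Lam V E l f v))\<^sup>2) summable_on ch u" if "u \<in> V" for u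
    using summable_on_cmult_left[OF weights_summable[OF that]] cong
    by (subst summable_on_cong[OF cong]) auto
  have 2: "(\<Sum>\<^sub>\<infinity>v\<in>ch u. (cmod (Lam V E l f v))\<^sup>2) = (sn u)\<^sup>2 * (cmod (f u))\<^sup>2" if "u \<in> V" for u
    unfolding shift_norm_power2[OF that] infsum_cmult_left'[symmetric]
    by (intro infsum_cong cong)
  have "Lam V E l f \<in> ell2 V \<longleftrightarrow> (\<lambda>v. (cmod (Lam V E l f v))\<^sup>2) summable_on V"
    by (auto simp: ell2_def Lam_def nonroots_def)
  also have "\<dots> \<longleftrightarrow> (\<lambda>u. \<Sum>\<^sub>\<infinity>v\<in>ch u. (cmod (Lam V E l f v))\<^sup>2) summable_on V"
    using 1 by (subst summable_on_tree_iff) auto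
  also have "\<dots> \<longleftrightarrow> (\<lambda>u. (sn u)\<^sup>2 * (cmod (f u))\<^sup>2) summable_on V"
    by (intro summable_on_cong 2)
  finally show ?thesis
    by (auto simp: wshift_def dom_def)
qed

text \<open>Testing the adjoint relation on the basis vector at \<open>u\<close> forces the image
  \<open>h\<close> of \<open>g\<close> to satisfy \<open>h u = ell2_inner (ch u) g (lam u)\<close>.
  Conversely the function defined by this formula satisfies the relation, by regrouping the sum over
  the fibres.\<close>

lemma dom_adj:
  "g \<in> dom (adj V (wshift V E l)) \<longleftrightarrow>
    g \<in> ell2 V \<and> (\<lambda>u. (cmod (ell2_inner (ch u) g (lam u)))\<^sup>2) summable_on V"
proof -
  have "(\<lambda>u. (cmod (ell2_inner (ch u) g (lam u)))\<^sup>2) summable_on V"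
    if g: "g \<in> ell2 V" and h: "h \<in> ell2 V"
      and eq: "\<forall>f\<in>dom (wshift V E l). ell2_inner V (the (wshift V E l f)) g = ell2_inner V f h" for h
  proof -
    have hu: "cmod (ell2_inner (ch u) g (lam u)) = cmod (h u)" if u: "u \<in> V" for u
    proof -
      have "ell2_inner V (lam u) g = ell2_inner V (indicator {u}) h"
        using bspec[OF eq, of "indicator {u}"] wshift_indicator[OF u] by (simp add: dom_def)
      also have "\<dots> = (\<Sum>\<^sub>\<infinity>v\<in>{u}. indicator {u} v * cnj (h v))"
        unfolding ell2_inner_def using u by (intro infsum_cong_neutral) auto
      also have "\<dots> = cnj (h u)"
        by simp
      also have "ell2_inner V (lam u) g = ell2_inner (ch u) (lam u) g"
        unfolding ell2_inner_def using Chi_subset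
        by (intro infsum_cong_neutral) (auto simp: lam_at_def)
      finally have "cnj (ell2_inner (ch u) g (lam u)) = cnj (h u)"
        by (simp add: ell2_inner_cnj)
      then show ?thesis
        by simp
    qed
    show ?thesis
      using ell2D(2)[OF h] by (subst summable_on_cong[where g = "\<lambda>u. (cmod (h u))\<^sup>2"]) (simp_all add: hu)
  qed
  moreover have "\<exists>h\<in>ell2 V. \<forall>f\<in>dom (wshift V E l).
      ell2_inner V (the (wshift V E l f)) g = ell2_inner V f h"
    if g: "g \<in> ell2 V" and sum: "(\<lambda>u. (cmod (ell2_inner (ch u) g (lam u)))\<^sup>2) summable_on V"
  proof
    define h where "h u = (if u \<in> V then ell2_inner (ch u) g (lam u) else 0)" for u
    have "(\<lambda>u. (cmod (h u))\<^sup>2) summable_on V"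
      using sum by (subst summable_on_cong[where g = "\<lambda>u. (cmod (ell2_inner (ch u) g (lam u)))\<^sup>2"])
        (simp_all add: h_def)
    then show "h \<in> ell2 V"
      by (simp add: ell2_def h_def)
    show "\<forall>f\<in>dom (wshift V E l). ell2_inner V (the (wshift V E l f)) g = ell2_inner V f h"
    proof
      fix f assume f: "f \<in> dom (wshift V E l)"
      then have Lf: "Lam V E l f \<in> ell2 V" and eq: "the (wshift V E l f) = Lam V E l f"
        by (auto simp: wshift_def dom_def split: if_splits)
      define F where "F v = Lam V E l f v * cnj (g v)" for v
      \<comment> \<open>Pairs of a parent and a child correspond to nonroots because parents are
        unique; summability over the pairs then justifies the iterated sum.\<close>
      have inj: "inj_on snd (Sigma V ch)"
        using disjoint_Chi by (force simp: inj_on_def disjoint_family_on_def)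
      have im: "snd ` Sigma V ch = nonroots V E"
        by (force simp: nonroots_eq)
      have "F summable_on V"
        unfolding F_def using Lf g by (rule ell2_mult_summable)
      then have "F summable_on nonroots V E"
        by (rule summable_on_subset) (auto simp: nonroots_def)
      then have sumF: "(\<lambda>x. F (snd x)) summable_on Sigma V ch"
        unfolding im[symmetric] summable_on_reindex[OF inj] by (simp add: o_def)
      have "ell2_inner V (Lam V E l f) g = infsum F (nonroots V E)"
        unfolding ell2_inner_def F_def
        by (intro infsum_cong_neutral) (auto simp: nonroots_def Lam_def)
      also have "\<dots> = infsum (\<lambda>x. F (snd x)) (Sigma V ch)"
        unfolding im[symmetric] infsum_reindex[OF inj] by (simp add: o_def)
      also have "\<dots> = (\<Sum>\<^sub>\<infinity>u\<in>V. \<Sum>\<^sub>\<infinity>v\<in>ch u. F v)"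
        using infsum_Sigma_banach[OF sumF] by simp
      also have "\<dots> = (\<Sum>\<^sub>\<infinity>u\<in>V. f u * cnj (h u))"
      proof (intro infsum_cong)
        fix u assume u: "u \<in> V"
        have "(\<Sum>\<^sub>\<infinity>v\<in>ch u. F v) = (\<Sum>\<^sub>\<infinity>v\<in>ch u. f u * (lam u v * cnj (g v)))"
          by (intro infsum_cong) (simp add: F_def Lam_Chi lam_at_def)
        also have "\<dots> = f u * ell2_inner (ch u) (lam u) g"
          by (simp add: infsum_cmult_right' ell2_inner_def)
        finally show "(\<Sum>\<^sub>\<infinity>v\<in>ch u. F v) = f u * cnj (h u)"
          using u by (simp add: h_def ell2_inner_cnj)
      qed
      finally show "ell2_inner V (the (wshift V E l f)) g = ell2_inner V f h"
        by (simp add: eq ell2_inner_def)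
    qed
  qed
  moreover have "g \<in> dom (adj V (wshift V E l)) \<longleftrightarrow> g \<in> ell2 V \<and> (\<exists>h\<in>ell2 V.
      \<forall>f\<in>dom (wshift V E l). ell2_inner V (the (wshift V E l f)) g = ell2_inner V f h)"
    unfolding domIff adj_def by simp
  ultimately show ?thesis
    by blast
qed

section \<open>Restriction to a fibre and the operator \<open>T_op V E l u\<close> on it\<close>

definition restr :: "'v \<Rightarrow> ('v \<Rightarrow> complex) \<Rightarrow> ('v \<Rightarrow> complex)" where
  "restr u g v = (if v \<in> ch u then g v else 0)"

lemma restr_ell2: "g \<in> ell2 V \<Longrightarrow> restr u g \<in> ell2 (ch u)"
  unfolding restr_def[abs_def] by (rule ell2_restrict[OF _ Chi_subset])

lemma A_form_restr:
  "A_form (ch u) (lam u) (restr u g) =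
    (\<Sum>\<^sub>\<infinity>v\<in>ch u. (cmod (g v))\<^sup>2) + (cmod (ell2_inner (ch u) g (lam u)))\<^sup>2"
  unfolding A_form_def ell2_norm_power2 ell2_inner_def
  by (simp add: restr_def cong: infsum_cong)

lemma norm_diag_op_restr:
  "(ell2_norm (ch u) (diag_op sn (restr u g)))\<^sup>2 = (\<Sum>\<^sub>\<infinity>v\<in>ch u. (sn v)\<^sup>2 * (cmod (g v))\<^sup>2)"
  unfolding ell2_norm_power2
  by (intro infsum_cong) (simp add: restr_def diag_op_def norm_mult power_mult_distrib)

lemma diag_op_ell2_iff:
  assumes "g \<in> ell2 (ch u)"
  shows "diag_op sn g \<in> ell2 (ch u) \<longleftrightarrow> (\<lambda>v. (sn v)\<^sup>2 * (cmod (g v))\<^sup>2) summable_on ch u"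
  using ell2D(1)[OF assms] by (auto simp: ell2_def diag_op_def norm_mult power_mult_distrib)

lemma M_op_eq:
  "M_op V E l u g =
    (if g \<in> ell2 (ch u) \<and> diag_op sn g \<in> ell2 (ch u) then Some (diag_op sn g) else None)"
proof -
  have "(\<lambda>v. complex_of_real (sn v) * g v) = diag_op sn g"
    by (simp add: diag_op_def fun_eq_iff)
  then show ?thesis
    by (simp add: M_op_def diag_op_ell2_iff)
qed

text \<open>The factored form \<open>M A^-1 M\<close> as a total function, in the shape used by the
  estimates of the locale \<open>fibre\<close>.\<close>

definition T :: "'v \<Rightarrow> ('v \<Rightarrow> complex) \<Rightarrow> ('v \<Rightarrow> complex)" where
  "T u k = diag_op sn (A_inv (ch u) (lam u) (diag_op sn k))"

text \<open>Expanding \<open>A_inv\<close> gives the correction term with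
  \<open><M k, lam u>\<close>, which equals \<open><k, M (lam u)>\<close> by symmetry. The scalar
  factors agree since \<open>sn u\<close> is the norm of \<open>lam u\<close>.\<close>

lemma T_op_eq:
  assumes fib: "fibre (ch u) (lam u) sn" and u: "u \<in> V"
  shows "T_op V E l u k = (if k \<in> ell2 (ch u) then Some (T u k) else None)"
proof -
  interpret fibre "ch u" "lam u" sn
    by (rule fib)
  have M_op: "M_op V E l u = (\<lambda>g. if g \<in> ell2 (ch u) then Some (M g) else None)"
    using diag_op_ell2 by (auto simp: M_op_eq)
  then have MM: "M_op V E l u \<circ>\<^sub>m M_op V E l u = (\<lambda>g. if g \<in> ell2 (ch u) then Some (M (M g)) else None)"
    using diag_op_ell2 by (auto simp: map_comp_def)
  have m: "the (M_op V E l u (lam u)) = M (lam u)"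
    using lam by (simp add: M_op)
  have inner: "ell2_inner (ch u) k (M (lam u)) = ell2_inner (ch u) (M k) (lam u)"
    by (rule M_sym[symmetric])
  have "T u k = (\<lambda>v. M (M k) v - complex_of_real (1 / (1 + (sn u)\<^sup>2)) *
      (ell2_inner (ch u) k (M (lam u)) * M (lam u) v))"
    unfolding T_def inner using u
    by (simp add: fun_eq_iff diag_op_def[of sn "A_inv _ _ _"] A_inv_def norm_lam)
      (simp add: diag_op_def algebra_simps)
  then show ?thesis
    unfolding T_op_def Let_def m MM
    by (simp add: op_minus_def op_scale_def rank_one_def domIff del: not_None_eq)
qed

text \<open>The domain of \<open>T_op V E l u\<close> lies inside that of the square of
  \<open>M_op V E l u\<close>, so if the former is the whole space, the multiplication operator is
  everywhere defined.\<close>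

lemma fibre_of_bounded_T_op:
  assumes u: "u \<in> V" and T: "bounded_op (ch u) (T_op V E l u)"
  shows "fibre (ch u) (lam u) sn"
proof
  show "lam u \<in> ell2 (ch u)"
    using u by (rule lam_ell2)
  fix f assume "f \<in> ell2 (ch u)"
  then have "f \<in> dom (T_op V E l u)"
    using T by (simp add: bounded_op_def)
  then show "diag_op sn f \<in> ell2 (ch u)"
    by (auto simp: T_op_def M_op_eq op_minus_def map_comp_def dom_def Let_def split: if_splits)
qed

lemma bounded_T_op:
  assumes fib: "fibre (ch u) (lam u) sn" and u: "u \<in> V"
    and C: "\<And>k. k \<in> ell2 (ch u) \<Longrightarrow> ell2_norm (ch u) (T u k) \<le> C * ell2_norm (ch u) k"
  shows "bounded_op (ch u) (T_op V E l u)"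
proof -
  interpret fibre "ch u" "lam u" sn
    by (rule fib)
  note T_eq = T_op_eq[OF fib u]
  have ell2: "T u k \<in> ell2 (ch u)" if "k \<in> ell2 (ch u)" for k
    using that by (simp add: T_def diag_op_ell2 Ainv_ell2)
  have lin: "T u (\<lambda>v. a * f v + b * g v) = (\<lambda>v. a * T u f v + b * T u g v)"
    if f: "f \<in> ell2 (ch u)" and g: "g \<in> ell2 (ch u)" for f g a b
  proof -
    \<comment> \<open>The sum is written as a difference with coefficient \<open>- b\<close> so that
      \<open>ell2_inner_diff_left\<close> applies.\<close>
    have "ell2_inner (ch u) (diag_op sn (\<lambda>v. a * f v + b * g v)) (lam u) =
        ell2_inner (ch u) (\<lambda>v. a * diag_op sn f v - (- b) * diag_op sn g v) (lam u)"
      by (simp add: diag_op_def algebra_simps ell2_inner_def)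
    also have "\<dots> = a * ell2_inner (ch u) (diag_op sn f) (lam u) + b * ell2_inner (ch u) (diag_op sn g) (lam u)"
      using f g lam by (simp only: ell2_inner_diff_left ell2_scale diag_op_ell2 ell2_inner_scale_left) simp
    finally show ?thesis
      by (simp add: T_def A_inv_def fun_eq_iff diag_op_def[of _ "A_inv _ _ _"])
        (simp add: diag_op_def algebra_simps add_divide_distrib)
  qed
  have "ell2_norm (ch u) (the (T_op V E l u k)) \<le> C * ell2_norm (ch u) k" if "k \<in> ell2 (ch u)" for k
    using C[OF that] that by (simp add: T_eq)
  moreover have "dom (T_op V E l u) = ell2 (ch u)" "ran (T_op V E l u) \<subseteq> ell2 (ch u)"
    using ell2 by (auto simp: T_eq dom_def ran_def split: if_splits)
  moreover have "the (T_op V E l u (\<lambda>v. a * f v + b * g v)) =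
      (\<lambda>v. a * the (T_op V E l u f) v + b * the (T_op V E l u g) v)"
    if "f \<in> ell2 (ch u)" "g \<in> ell2 (ch u)" for f g a b
    using that by (simp add: T_eq lin ell2_add ell2_scale)
  ultimately show ?thesis
    unfolding bounded_op_def by blast
qed

section \<open>From a uniform form bound to the inclusion of domains\<close>

text \<open>Summing the bound over \<open>u\<close> dominates the series for the shift domain by two
  convergent ones: the squared norm of \<open>g\<close> and the series for the adjoint
  domain.\<close>

lemma dom_adj_subset_of_form_bound:
  assumes fib: "\<And>u. u \<in> nonleaves V E \<Longrightarrow> fibre (ch u) (lam u) sn"
    and bound: "\<And>u g. u \<in> nonleaves V E \<Longrightarrow> g \<in> ell2 (ch u) \<Longrightarrow>
      (ell2_norm (ch u) (diag_op sn g))\<^sup>2 \<le> C * A_form (ch u) (lam u) g"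
  shows "dom (adj V (wshift V E l)) \<subseteq> dom (wshift V E l)"
proof
  fix g assume "g \<in> dom (adj V (wshift V E l))"
  then have g: "g \<in> ell2 V"
    and sum: "(\<lambda>u. (cmod (ell2_inner (ch u) g (lam u)))\<^sup>2) summable_on V"
    by (auto simp: dom_adj)
  have "(\<lambda>u. \<Sum>\<^sub>\<infinity>v\<in>ch u. (cmod (g v))\<^sup>2) summable_on V"
    using ell2D(2)[OF g] by (simp add: summable_on_tree_iff)
  then have sum': "(\<lambda>u. C * ((\<Sum>\<^sub>\<infinity>v\<in>ch u. (cmod (g v))\<^sup>2) +
      (cmod (ell2_inner (ch u) g (lam u)))\<^sup>2)) summable_on V"
    using sum by (intro summable_on_cmult_right summable_on_add)
  have leaf: "ch u = {}" if "u \<in> V" "u \<notin> nonleaves V E" for u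
    using that by (simp add: nonleaves_def)
  \<comment> \<open>A bound on \<open>infsum\<close> alone would not show this, as
    \<open>infsum\<close> is 0 for families that are not summable. Over leaves the fibre is
    empty.\<close>
  have 1: "(\<lambda>v. (sn v)\<^sup>2 * (cmod (g v))\<^sup>2) summable_on ch u" if u: "u \<in> V" for u
  proof (cases "u \<in> nonleaves V E")
    case True
    interpret fibre "ch u" "lam u" sn
      by (rule fib[OF True])
    have "(\<lambda>v. (sn v)\<^sup>2 * (cmod (restr u g v))\<^sup>2) summable_on ch u"
      using diag_op_ell2[OF restr_ell2[OF g]] diag_op_ell2_iff[OF restr_ell2[OF g]] by blast
    then show ?thesis
      by (subst summable_on_cong[where g = "\<lambda>v. (sn v)\<^sup>2 * (cmod (restr u g v))\<^sup>2"])
        (auto simp: restr_def)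
  qed (use u leaf in simp)
  have 2: "(\<Sum>\<^sub>\<infinity>v\<in>ch u. (sn v)\<^sup>2 * (cmod (g v))\<^sup>2) \<le>
      C * ((\<Sum>\<^sub>\<infinity>v\<in>ch u. (cmod (g v))\<^sup>2) + (cmod (ell2_inner (ch u) g (lam u)))\<^sup>2)" if u: "u \<in> V" for u
  proof (cases "u \<in> nonleaves V E")
    case True
    then show ?thesis
      using bound[OF True restr_ell2[OF g]] by (simp only: A_form_restr norm_diag_op_restr)
  qed (use u leaf in \<open>simp add: ell2_inner_def\<close>)
  have "(\<lambda>u. \<Sum>\<^sub>\<infinity>v\<in>ch u. (sn v)\<^sup>2 * (cmod (g v))\<^sup>2) summable_on V"
    by (rule summable_on_comparison_test[OF sum' 2]) (auto intro: infsum_nonneg)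
  then have "(\<lambda>v. (sn v)\<^sup>2 * (cmod (g v))\<^sup>2) summable_on V"
    using 1 by (simp add: summable_on_tree_iff)
  then show "g \<in> dom (wshift V E l)"
    using g by (simp add: dom_wshift)
qed

section \<open>From the inclusion of domains to a uniform form bound\<close>

text \<open>Otherwise let \<open>g\<close> be the inverse of \<open>sn\<close> on a sparse infinite
  set \<open>J\<close> of children of \<open>u\<close>. Being supported in one fibre,
  \<open>g\<close> lies in the domain of the adjoint, whereas
  \<open>(sn v)\<^sup>2 * (cmod (g v))\<^sup>2\<close> is 1 on \<open>J\<close>.\<close>

lemma sn_bounded_of_dom_adj_subset:
  assumes sub: "dom (adj V (wshift V E l)) \<subseteq> dom (wshift V E l)" and u: "u \<in> V"
  obtains K where "\<And>v. v \<in> ch u \<Longrightarrow> (sn v)\<^sup>2 \<le> K"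
proof -
  have "\<exists>K. \<forall>v\<in>ch u. (sn v)\<^sup>2 \<le> K"
  proof (rule ccontr)
    assume "\<not> ?thesis"
    then have "\<exists>v\<in>ch u. K < (sn v)\<^sup>2" for K
      by (meson not_le)
    then obtain J where J: "J \<subseteq> ch u" "infinite J" "\<And>v. v \<in> J \<Longrightarrow> 0 < (sn v)\<^sup>2"
      and sumJ: "(\<lambda>v. inverse ((sn v)\<^sup>2)) summable_on J"
      using unbounded_imp_summable_inverse[of "ch u" "\<lambda>v. (sn v)\<^sup>2"] by metis
    define g where "g v = (if v \<in> J then complex_of_real (inverse (sn v)) else 0)" for v
    have "(\<lambda>v. (cmod (g v))\<^sup>2) summable_on J \<longleftrightarrow> (\<lambda>v. inverse ((sn v)\<^sup>2)) summable_on J"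
      by (intro summable_on_cong) (simp add: g_def norm_inverse power_inverse)
    then have gJ: "g \<in> ell2 J"
      using sumJ by (simp add: ell2_def g_def)
    have "J \<subseteq> V"
      using J(1) Chi_subset by blast
    with gJ have g: "g \<in> ell2 V"
      by (rule ell2_extend)
    have zero: "ell2_inner (ch w) g (lam w) = 0" if "w \<noteq> u" for w
    proof -
      have "g v = 0" if "v \<in> ch w" for v
        using par_eq[OF that] par_eq[of v u] J(1) \<open>w \<noteq> u\<close> by (auto simp: g_def)
      then show ?thesis
        by (simp add: ell2_inner_def infsum_0)
    qed
    have "finite {w \<in> V. (cmod (ell2_inner (ch w) g (lam w)))\<^sup>2 \<noteq> 0}"
      by (rule finite_subset[of _ "{u}"]) (use zero in auto)
    then have "(\<lambda>w. (cmod (ell2_inner (ch w) g (lam w)))\<^sup>2) summable_on V"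
      by (rule finite_nonzero_values_imp_summable_on)
    with g have "g \<in> dom (adj V (wshift V E l))"
      by (simp add: dom_adj)
    with sub have "g \<in> dom (wshift V E l)"
      by blast
    then have "(\<lambda>v. (sn v)\<^sup>2 * (cmod (g v))\<^sup>2) summable_on V"
      by (simp add: dom_wshift)
    then have "(\<lambda>v. (sn v)\<^sup>2 * (cmod (g v))\<^sup>2) summable_on J"
      by (rule summable_on_subset[OF _ \<open>J \<subseteq> V\<close>])
    also have "?this \<longleftrightarrow> (\<lambda>v. 1::real) summable_on J"
      using J(3) by (intro summable_on_cong)
        (auto simp: g_def norm_inverse power_inverse)
    finally show False
      using infsum_diverge_constant[OF J(2), of "1::real"] by simp
  qed
  then show thesis
    using that by blast
qed

lemma norm_diag_op_le:
  assumes g: "g \<in> ell2 (ch u)" and K: "\<And>v. v \<in> ch u \<Longrightarrow> (sn v)\<^sup>2 \<le> K"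
  shows "diag_op sn g \<in> ell2 (ch u)"
    and "(ell2_norm (ch u) (diag_op sn g))\<^sup>2 \<le> K * (ell2_norm (ch u) g)\<^sup>2"
proof -
  have sum: "(\<lambda>v. K * (cmod (g v))\<^sup>2) summable_on ch u"
    by (intro summable_on_cmult_right ell2D(2)[OF g])
  have sum': "(\<lambda>v. (sn v)\<^sup>2 * (cmod (g v))\<^sup>2) summable_on ch u"
    by (rule summable_on_comparison_test[OF sum]) (auto intro: mult_right_mono K)
  then show "diag_op sn g \<in> ell2 (ch u)"
    by (simp add: diag_op_ell2_iff[OF g])
  have "(ell2_norm (ch u) (diag_op sn g))\<^sup>2 = (\<Sum>\<^sub>\<infinity>v\<in>ch u. (sn v)\<^sup>2 * (cmod (g v))\<^sup>2)"
    unfolding ell2_norm_power2 by (simp add: diag_op_def norm_mult power_mult_distrib)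
  also have "\<dots> \<le> (\<Sum>\<^sub>\<infinity>v\<in>ch u. K * (cmod (g v))\<^sup>2)"
    by (rule infsum_mono[OF sum' sum]) (intro mult_right_mono K, auto)
  also have "\<dots> = K * (ell2_norm (ch u) g)\<^sup>2"
    by (simp add: ell2_norm_power2 infsum_cmult_right')
  finally show "(ell2_norm (ch u) (diag_op sn g))\<^sup>2 \<le> K * (ell2_norm (ch u) g)\<^sup>2" .
qed

lemma fibre_of_dom_adj_subset:
  assumes "dom (adj V (wshift V E l)) \<subseteq> dom (wshift V E l)" "u \<in> V"
  shows "fibre (ch u) (lam u) sn"
proof
  obtain K where "\<And>v. v \<in> ch u \<Longrightarrow> (sn v)\<^sup>2 \<le> K"
    using sn_bounded_of_dom_adj_subset[OF assms] by blast
  then show "diag_op sn f \<in> ell2 (ch u)" if "f \<in> ell2 (ch u)" for f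
    using norm_diag_op_le(1)[OF that] by blast
qed (use assms lam_ell2 in auto)

text \<open>
  \<open>c u\<close> is the best constant on the fibre over \<open>u\<close>. If these constants were unbounded, a sum of
  almost extremal functions over a sequence of distinct fibres would lie in the domain of the
  adjoint but not in that of the weighted shift.
\<close>

lemma form_bound_of_dom_adj_subset:
  assumes sub: "dom (adj V (wshift V E l)) \<subseteq> dom (wshift V E l)"
  obtains C where "0 \<le> C" "\<And>u g. u \<in> V \<Longrightarrow> g \<in> ell2 (ch u) \<Longrightarrow>
    (ell2_norm (ch u) (diag_op sn g))\<^sup>2 \<le> C * A_form (ch u) (lam u) g"
proof -
  define Q where "Q u g = (ell2_norm (ch u) (diag_op sn g))\<^sup>2" for u g
  define N where "N u g = A_form (ch u) (lam u) g" for u g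
  define B where "B u = {g \<in> ell2 (ch u). N u g \<le> 1}" for u
  define c where "c u = (SUP g\<in>B u. Q u g)" for u
  have Q_scale: "Q u (\<lambda>v. a * g v) = (cmod a)\<^sup>2 * Q u g" for u a g
    by (simp add: Q_def diag_op_scale ell2_norm_scale power_mult_distrib)
  have N_scale: "N u (\<lambda>v. a * g v) = (cmod a)\<^sup>2 * N u g" for u a g
    by (simp add: N_def A_form_scale)
  have norm_le_N: "(ell2_norm (ch u) g)\<^sup>2 \<le> N u g" for u g
    by (simp add: N_def A_form_def)
  have zero_B: "(\<lambda>v. 0) \<in> B u" for u
    using ell2_zero by (simp add: B_def N_def A_form_def ell2_norm_def ell2_inner_def)
  \<comment> \<open>The real supremum \<open>c u\<close> is informative only for a set bounded
    above; the bound comes from that of \<open>sn\<close> on the single fibre.\<close>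
  have bdd: "bdd_above (Q u ` B u)" if u: "u \<in> V" for u
  proof -
    obtain K where K: "\<And>v. v \<in> ch u \<Longrightarrow> (sn v)\<^sup>2 \<le> K"
      using sn_bounded_of_dom_adj_subset[OF sub u] by blast
    have "Q u g \<le> \<bar>K\<bar>" if "g \<in> B u" for g
    proof -
      have "g \<in> ell2 (ch u)" and N: "N u g \<le> 1"
        using that by (auto simp: B_def)
      then have "Q u g \<le> K * (ell2_norm (ch u) g)\<^sup>2"
        unfolding Q_def using K by (intro norm_diag_op_le(2))
      also have "\<dots> \<le> \<bar>K\<bar> * 1"
        using order_trans[OF norm_le_N N] by (intro mult_mono) auto
      finally show ?thesis
        by simp
    qed
    then show ?thesis
      by (auto intro!: bdd_aboveI)
  qed
  have Q_le: "Q u g \<le> c u * N u g" if u: "u \<in> V" and g: "g \<in> ell2 (ch u)" for u g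
  \<comment> \<open>Rescaling into \<open>B u\<close> needs a positive \<open>N u g\<close>; if it
    is zero, so is the norm of \<open>g\<close>, and with it \<open>Q u g\<close>.\<close>
  proof (cases "N u g = 0")
    case True
    obtain K where K: "\<And>v. v \<in> ch u \<Longrightarrow> (sn v)\<^sup>2 \<le> K"
      using sn_bounded_of_dom_adj_subset[OF sub u] by blast
    have "ell2_norm (ch u) g = 0"
      using norm_le_N[of u g] True by simp
    then show ?thesis
      using norm_diag_op_le(2)[OF g K] True by (simp add: Q_def)
  next
    case False
    then have N: "0 < N u g"
      using A_form_nonneg[of "ch u" "lam u" g] by (simp add: N_def)
    define a where "a = complex_of_real (1 / sqrt (N u g))"
    have a: "(cmod a)\<^sup>2 = 1 / N u g"
      using N by (simp add: a_def norm_divide power_divide)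
    have "(\<lambda>v. a * g v) \<in> B u"
      using N g by (simp add: B_def ell2_scale N_scale a)
    then have "Q u (\<lambda>v. a * g v) \<le> c u"
      unfolding c_def by (rule cSUP_upper[OF _ bdd[OF u]])
    then show ?thesis
      using N by (simp add: Q_scale a field_simps)
  qed
  have "\<exists>K. \<forall>u\<in>V. c u \<le> K"
  proof (rule ccontr)
    assume "\<not> ?thesis"
    then have "\<exists>u\<in>V. K < c u" for K
      by (meson not_le)
    then obtain J where J: "J \<subseteq> V" "infinite J" "\<And>u. u \<in> J \<Longrightarrow> 0 < c u"
      and sumJ: "(\<lambda>u. inverse (c u)) summable_on J"
      using unbounded_imp_summable_inverse[of V c] by metis
    have "\<exists>g. g \<in> B u \<and> c u / 2 < Q u g" if "u \<in> J" for u
    proof -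
      have "c u / 2 < (SUP g\<in>B u. Q u g)"
        using J(3)[OF that] by (simp flip: c_def)
      moreover have "B u \<noteq> {}" "bdd_above (Q u ` B u)"
        using zero_B bdd that J(1) by auto
      ultimately have "\<exists>g\<in>B u. c u / 2 < Q u g"
        using less_cSUP_iff[of "B u" "Q u" "c u / 2"] by blast
      then show ?thesis
        by blast
    qed
    then obtain G where G: "\<And>u. u \<in> J \<Longrightarrow> G u \<in> B u" "\<And>u. u \<in> J \<Longrightarrow> c u / 2 < Q u (G u)"
      by metis
    \<comment> \<open>This scaling makes the form of the piece over \<open>u\<close> at most
      \<open>inverse (c u)\<close>, which is summable, while its \<open>Q\<close> value stays at
      least 1/2.\<close>
    define a where "a u = complex_of_real (1 / sqrt (c u))" for u
    have a: "(cmod (a u))\<^sup>2 = inverse (c u)" if "u \<in> J" for u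
      using J(3)[OF that] by (simp add: a_def norm_divide power_divide inverse_eq_divide)
    \<comment> \<open>The pieces are glued into one function; \<open>par E v\<close> tells which
      fibre contains \<open>v\<close>.\<close>
    define g where "g v = (if v \<in> nonroots V E \<and> par E v \<in> J
      then a (par E v) * G (par E v) v else 0)" for v
    have g_J: "restr u g = (\<lambda>v. a u * G u v)" if "u \<in> J" for u
      using that G(1)[OF that]
      by (auto simp: fun_eq_iff restr_def g_def par_eq Chi_nonroots B_def ell2D(1))
    have g_not_J: "g v = 0" if "u \<notin> J" "v \<in> ch u" for u v
      using that by (simp add: g_def par_eq)
    define S where "S u = (\<Sum>\<^sub>\<infinity>v\<in>ch u. (cmod (g v))\<^sup>2) + (cmod (ell2_inner (ch u) g (lam u)))\<^sup>2" for u
    have S_J: "S u \<le> inverse (c u)" if "u \<in> J" for u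
    proof -
      have "S u = inverse (c u) * N u (G u)"
        using A_form_restr[of u g] N_scale[of u "a u" "G u"] that
        by (simp add: S_def N_def g_J a)
      also have "\<dots> \<le> inverse (c u) * 1"
        using G(1)[OF that] J(3)[OF that] by (intro mult_left_mono) (auto simp: B_def)
      finally show ?thesis
        by simp
    qed
    have S_not_J: "S u = 0" if "u \<notin> J" for u
      using g_not_J[OF that] by (simp add: S_def ell2_inner_def infsum_0)
    have S_nonneg: "0 \<le> S u" for u
      by (simp add: S_def infsum_nonneg)
    have "S summable_on J"
      using sumJ S_J S_nonneg by (rule summable_on_comparison_test)
    moreover have "S summable_on V \<longleftrightarrow> S summable_on J"
      using J(1) S_not_J by (intro summable_on_cong_neutral) auto
    ultimately have S: "S summable_on V"
      by simp
    have "(\<lambda>u. \<Sum>\<^sub>\<infinity>v\<in>ch u. (cmod (g v))\<^sup>2) summable_on V"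
      by (rule summable_on_comparison_test[OF S]) (auto simp: S_def infsum_nonneg)
    moreover have "(\<lambda>v. (cmod (g v))\<^sup>2) summable_on ch u" if "u \<in> V" for u
    proof (cases "u \<in> J")
      case True
      have "restr u g \<in> ell2 (ch u)"
        unfolding g_J[OF True] using G(1)[OF True] by (auto simp: B_def intro: ell2_scale)
      then show ?thesis
        using ell2D(2)[of "restr u g" "ch u"]
        by (subst summable_on_cong[where g = "\<lambda>v. (cmod (restr u g v))\<^sup>2"]) (auto simp: restr_def)
    next
      case False
      then show ?thesis
        using g_not_J summable_on_cong[of "ch u" "\<lambda>v. (cmod (g v))\<^sup>2" "\<lambda>v. 0"] by simp
    qed
    ultimately have "(\<lambda>v. (cmod (g v))\<^sup>2) summable_on V"
      by (simp add: summable_on_tree_iff)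
    then have "g \<in> ell2 V"
      by (auto simp: ell2_def g_def nonroots_def)
    moreover have "(\<lambda>u. (cmod (ell2_inner (ch u) g (lam u)))\<^sup>2) summable_on V"
      by (rule summable_on_comparison_test[OF S]) (auto simp: S_def infsum_nonneg)
    ultimately have "g \<in> dom (wshift V E l)"
      using sub dom_adj by blast
    then have "(\<lambda>v. (sn v)\<^sup>2 * (cmod (g v))\<^sup>2) summable_on V"
      by (simp add: dom_wshift)
    then have "(\<lambda>u. \<Sum>\<^sub>\<infinity>v\<in>ch u. (sn v)\<^sup>2 * (cmod (g v))\<^sup>2) summable_on V"
      by (simp add: summable_on_tree_iff)
    then have "(\<lambda>u. \<Sum>\<^sub>\<infinity>v\<in>ch u. (sn v)\<^sup>2 * (cmod (g v))\<^sup>2) summable_on J"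
      using J(1) by (rule summable_on_subset)
    \<comment> \<open>Infinitely many fibres contribute at least 1/2 each, which contradicts
      summability.\<close>
    moreover have "1 / 2 \<le> (\<Sum>\<^sub>\<infinity>v\<in>ch u. (sn v)\<^sup>2 * (cmod (g v))\<^sup>2)" if "u \<in> J" for u
    proof -
      have "(\<Sum>\<^sub>\<infinity>v\<in>ch u. (sn v)\<^sup>2 * (cmod (g v))\<^sup>2) = inverse (c u) * Q u (G u)"
        using norm_diag_op_restr[of u g] Q_scale[of u "a u" "G u"] that
        by (simp add: Q_def g_J a)
      moreover have "1 / 2 \<le> inverse (c u) * Q u (G u)"
        using G(2)[OF that] J(3)[OF that] by (simp add: field_simps)
      ultimately show ?thesis
        by simp
    qed
    ultimately have "(\<lambda>u. 1 / 2 :: real) summable_on J"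
      by (rule summable_on_comparison_test) auto
    then show False
      using infsum_diverge_constant[OF J(2), of "1 / 2 :: real"] by simp
  qed
  then obtain K where K: "\<And>u. u \<in> V \<Longrightarrow> c u \<le> K"
    by blast
  have "Q u g \<le> \<bar>K\<bar> * N u g" if "u \<in> V" "g \<in> ell2 (ch u)" for u g
  proof -
    have "c u * N u g \<le> \<bar>K\<bar> * N u g"
      using K[OF that(1)] by (intro mult_right_mono) (auto simp: N_def A_form_nonneg)
    then show ?thesis
      using Q_le[OF that] by simp
  qed
  then show thesis
    by (intro that[of "\<bar>K\<bar>"]) (auto simp: Q_def N_def)
qed

section \<open>The equivalence\<close>

text \<open>Both directions pass through the form bound. \<open>T_le_of_M_le\<close> and
  \<open>M_le_of_T_le\<close> exchange it with a norm bound on \<open>T u\<close> without changing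
  the constant, so uniformity in \<open>u\<close> is preserved.\<close>

lemma dom_adj_subset_iff:
  "dom (adj V (wshift V E l)) \<subseteq> dom (wshift V E l) \<longleftrightarrow>
    (\<forall>u\<in>nonleaves V E. lam u \<in> dom (M_op V E l u) \<and> bounded_op (ch u) (T_op V E l u)) \<and>
    bdd_above ((\<lambda>u. op_norm (ch u) (T_op V E l u)) ` nonleaves V E)" (is "?sub \<longleftrightarrow> ?bounded")
proof
  assume sub: ?sub
  obtain C where C: "0 \<le> C" "\<And>u g. u \<in> V \<Longrightarrow> g \<in> ell2 (ch u) \<Longrightarrow>
      (ell2_norm (ch u) (diag_op sn g))\<^sup>2 \<le> C * A_form (ch u) (lam u) g"
    using form_bound_of_dom_adj_subset[OF sub] by metis
  have "lam u \<in> dom (M_op V E l u) \<and> bounded_op (ch u) (T_op V E l u) \<and>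
      op_norm (ch u) (T_op V E l u) \<le> C" if "u \<in> nonleaves V E" for u
  proof -
    have u: "u \<in> V"
      using that by (simp add: nonleaves_def)
    have fib: "fibre (ch u) (lam u) sn"
      using sub u by (rule fibre_of_dom_adj_subset)
    then interpret fibre "ch u" "lam u" sn .
    have T: "ell2_norm (ch u) (T u k) \<le> C * ell2_norm (ch u) k" if "k \<in> ell2 (ch u)" for k
      unfolding T_def using that C u by (intro T_le_of_M_le)
    have "op_norm (ch u) (T_op V E l u) \<le> C"
      using C(1) T by (intro op_norm_leI) (auto simp: T_op_eq[OF fib u])
    then show ?thesis
      using lam diag_op_ell2[OF lam] bounded_T_op[OF fib u T] by (auto simp: M_op_eq dom_def)
  qed
  then show ?bounded
    by (auto intro!: bdd_aboveI)
next
  assume bounded: ?bounded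
  then obtain K where K: "\<And>u. u \<in> nonleaves V E \<Longrightarrow> op_norm (ch u) (T_op V E l u) \<le> K"
    by (auto simp: bdd_above_def)
  have fib: "fibre (ch u) (lam u) sn" if "u \<in> nonleaves V E" for u
    using that bounded by (intro fibre_of_bounded_T_op) (auto simp: nonleaves_def)
  show ?sub
  \<comment> \<open>The absolute value supplies the nonnegative constant that
    \<open>M_le_of_T_le\<close> asks for.\<close>
  proof (rule dom_adj_subset_of_form_bound[OF fib, where C = "\<bar>K\<bar>"])
    fix u g assume u: "u \<in> nonleaves V E" and g: "g \<in> ell2 (ch u)"
    then have "u \<in> V"
      by (simp add: nonleaves_def)
    note T_eq = T_op_eq[OF fib[OF u] this]
    interpret fibre "ch u" "lam u" sn
      by (rule fib[OF u])
    have "ell2_norm (ch u) (T u k) \<le> \<bar>K\<bar> * ell2_norm (ch u) k" if k: "k \<in> ell2 (ch u)" for k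
    proof -
      have "ell2_norm (ch u) (T u k) \<le> op_norm (ch u) (T_op V E l u) * ell2_norm (ch u) k"
        using op_norm_le[of "ch u" "T_op V E l u" k] bounded u k by (simp add: T_eq)
      also have "\<dots> \<le> \<bar>K\<bar> * ell2_norm (ch u) k"
        using K[OF u] by (intro mult_right_mono ell2_norm_nonneg) simp
      finally show ?thesis .
    qed
    then show "(ell2_norm (ch u) (diag_op sn g))\<^sup>2 \<le> \<bar>K\<bar> * A_form (ch u) (lam u) g"
      using g by (intro M_le_of_T_le) (auto simp: T_def)
  qed
qed

end

text \<open>Finiteness of the supremum is rendered by \<open>bdd_above\<close>, which also holds for
  the empty family arising from a tree with a single vertex.\<close>

theorem theorem4p2p2:
  fixes V :: "'v set" and E :: "('v \<times> 'v) set" and l :: "'v \<Rightarrow> complex"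
  assumes "directed_tree V E"
    and "densely_defined V (wshift V E l)"
  shows "dom (adj V (wshift V E l)) \<subseteq> dom (wshift V E l) \<longleftrightarrow>
    (\<forall>u\<in>nonleaves V E.
       lam_at V E l u \<in> dom (M_op V E l u) \<and> bounded_op (Chi V E u) (T_op V E l u)) \<and>
    bdd_above ((\<lambda>u. op_norm (Chi V E u) (T_op V E l u)) ` nonleaves V E)"
  using assms by (intro tree_shift.dom_adj_subset_iff tree_shift.intro)

end
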